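(* Let $m$ be a positive odd integer with odd root $a$, and write $a = 2^y \cdot 3^u \cdot b - 1$ with integers $y \ge 1$, $u \ge 0$ and $b \geq 1$ an odd integer not divisible by $3$, so that the multiplicative factor of the root is $2^y \cdot 3^u$. Then one reduced Collatz iteration multiplies the multiplicative factor of the root by $3 \cdot 2^{-1}$, that is, the root of $R(m)$ is $$\left(3 \cdot 2^{-1}\right)\cdot 2^{y}\cdot 3^{u} \cdot b - 1 = 2^{y-1} \cdot 3^{u+1} \cdot b - 1.$$ (Consequently this applies at each iteration for as long as the root is odd.)
   Context: For a positive odd integer $m$, the root of $m$ is the integer $a \ge 0$ with $m = 2a+1$. The reduced Collatz iteration sends a positive odd integer $m$ to $R(m) = \frac{3m+1}{2^x}$, where $2^x$ is the highest power of $2$ dividing $3m+1$. When a root is written as $2^y \cdot 3^u \cdot b - 1$ with $y,u \ge 0$ and $b$ odd and not a multiple of $3$, the factor $2^y \cdot 3^u$ is called the multiplicative factor of the root. *)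

theory Defs
  imports Complex_Main "HOL-Computational_Algebra.Primes"
begin

definition collatz_root :: "int \<Rightarrow> int" where
  "collatz_root m = (THE a. a \<ge> 0 \<and> m = 2 * a + 1)"

(* The division is exact: 2 ^ multiplicity 2 n is the highest power of 2 dividing n \<noteq> 0. *)
definition reduced_collatz :: "int \<Rightarrow> int" where
  "reduced_collatz m = (3 * m + 1) div 2 ^ multiplicity 2 (3 * m + 1)"

(* Every root a \<ge> 0 has exactly one such decomposition, since a + 1 > 0. *)
definition mult_factor :: "int \<Rightarrow> int" where
  "mult_factor a = (THE f. \<exists>y u :: nat. \<exists>b :: int.
     a = 2 ^ y * 3 ^ u * b - 1 \<and> odd b \<and> \<not> 3 dvd b \<and> f = 2 ^ y * 3 ^ u)"

end

theory Submission
  imports Defs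
begin

text \<open>
  If the root is \<open>2 ^ y * c - 1\<close>, then \<open>m = 2 ^ (y + 1) * c - 1\<close> and
  \<open>3 * m + 1 = 2 * (2 ^ y * (3 * c) - 1)\<close>, where the second factor is odd because \<open>y \<ge> 1\<close>.
  So exactly one factor 2 is divided out, and one power of 2 in the root is traded for one
  power of 3. The root stays odd exactly as long as a power of 2 is left to trade.
\<close>

lemma collatz_root_eq: "a \<ge> 0 \<Longrightarrow> collatz_root (2 * a + 1) = a"
  unfolding collatz_root_def by (rule the_equality) auto

lemma multiplicity_power_times:
  fixes p x :: int
  assumes "p \<noteq> 0" "\<not> p dvd x"
  shows "multiplicity p (p ^ k * x) = k"
  by (rule multiplicity_eqI) (use assms in auto)

text \<open>The exponents can be read off the product as its multiplicities at 2 and 3, since the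
  remaining cofactor is coprime to the prime in question. Two decompositions of the same root
  therefore share both exponents, which makes the description in \<open>mult_factor\<close>
  unique.\<close>

lemma mult_factor_eq:
  fixes b :: int
  assumes "odd b" "\<not> 3 dvd b"
  shows "mult_factor (2 ^ y * 3 ^ u * b - 1) = 2 ^ y * 3 ^ u"
proof -
  have exponents: "multiplicity 2 (2 ^ v * 3 ^ w * c) = v \<and> multiplicity 3 (2 ^ v * 3 ^ w * c) = w"
    if "odd c" "\<not> 3 dvd c" for v w :: nat and c :: int
  proof
    have "odd (3 ^ w * c)"
      using that by simp
    then show "multiplicity 2 (2 ^ v * 3 ^ w * c) = v"
      using multiplicity_power_times[of 2 "3 ^ w * c" v] by (simp add: mult.assoc)
    have "prime (3 :: int)"
      by simp
    moreover have "\<not> (3 :: int) dvd 2"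
      by presburger
    ultimately have "\<not> 3 dvd 2 ^ v * c"
      using that by (metis prime_dvd_mult_iff prime_dvd_power)
    then show "multiplicity 3 (2 ^ v * 3 ^ w * c) = w"
      using multiplicity_power_times[of 3 "2 ^ v * c" w] by (simp add: mult_ac)
  qed
  show ?thesis
    unfolding mult_factor_def
  proof (rule the_equality)
    fix f :: int
    assume "\<exists>y' u' b'. 2 ^ y * 3 ^ u * b - 1 = 2 ^ y' * 3 ^ u' * b' - 1 \<and> odd b' \<and> \<not> 3 dvd b'
              \<and> f = 2 ^ y' * 3 ^ u'"
    then obtain v w c where "2 ^ y * 3 ^ u * b = 2 ^ v * 3 ^ w * c" "odd c" "\<not> 3 dvd c"
      "f = 2 ^ v * 3 ^ w"
      by auto
    then show "f = 2 ^ y * 3 ^ u"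
      using exponents[of b y u] exponents[of c v w] assms by simp
  qed (use assms in blast)
qed

lemma collatz_root_power:
  fixes c :: int
  assumes "c \<ge> 1"
  shows "collatz_root (2 ^ Suc y * c - 1) = 2 ^ y * c - 1"
proof -
  have "2 ^ y * c \<ge> 1"
    using assms by (simp add: one_le_mult_iff int_one_le_iff_zero_less)
  then show ?thesis
    using collatz_root_eq[of "2 ^ y * c - 1"] by (simp add: algebra_simps)
qed

text \<open>Of the two \<open>Suc\<close> in the exponent, one comes from passing from the root to
  the number, and the other says that the root \<open>2 ^ Suc y * c - 1\<close> is odd.\<close>

lemma reduced_collatz_power:
  fixes c :: int
  shows "reduced_collatz (2 ^ Suc (Suc y) * c - 1) = 2 ^ Suc y * (3 * c) - 1"
proof -
  \<comment> \<open>The factor 2 is written \<open>2 ^ 1\<close> so that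
    \<open>multiplicity_power_times\<close> applies with exponent 1.\<close>
  have split: "3 * (2 ^ Suc (Suc y) * c - 1) + 1 = 2 ^ 1 * (2 ^ Suc y * (3 * c) - 1)"
    by simp
  have "odd (2 ^ Suc y * (3 * c) - 1)"
    by simp
  then show ?thesis
    unfolding reduced_collatz_def split
    by (subst multiplicity_power_times) auto
qed

text \<open>Each odd root certifies that a power of 2 is still present. The bound
  \<open>k\<le>n\<close> covers \<open>n + 1\<close> roots while only \<open>n\<close> powers have
  been traded, so at least one remains in the root of the last iterate; \<open>z\<close> counts
  those beyond it.\<close>

lemma reduced_collatz_funpow:
  fixes b :: int
  assumes "b \<ge> 1" "odd b"
    and "\<forall>k\<le>n. odd (collatz_root ((reduced_collatz ^^ k) (2 ^ Suc y * 3 ^ u * b - 1)))"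
  shows "\<exists>z. y = Suc (n + z) \<and>
    (reduced_collatz ^^ n) (2 ^ Suc y * 3 ^ u * b - 1) = 2 ^ Suc (Suc z) * 3 ^ (u + n) * b - 1"
  using assms(3)
proof (induction n)
  case 0
  then have "odd (2 ^ y * (3 ^ u * b) - 1)"
    using collatz_root_power[of "3 ^ u * b" y] assms(1)
    by (simp add: one_le_mult_iff int_one_le_iff_zero_less mult.assoc)
  \<comment> \<open>For \<open>y = 0\<close> the root would be an odd number minus 1, hence
    even.\<close>
  then show ?case
    using assms(2) by (cases y) auto
next
  case (Suc n)
  then obtain z where z: "y = Suc (n + z)"
    "(reduced_collatz ^^ n) (2 ^ Suc y * 3 ^ u * b - 1) = 2 ^ Suc (Suc z) * 3 ^ (u + n) * b - 1"
    by auto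
  have step: "(reduced_collatz ^^ Suc n) (2 ^ Suc y * 3 ^ u * b - 1) = 2 ^ Suc z * (3 ^ (u + Suc n) * b) - 1"
    using reduced_collatz_power[of z "3 ^ (u + n) * b"] z(2) by (simp add: mult_ac)
  have "3 ^ (u + Suc n) * b \<ge> 1"
    using assms(1) by (simp add: int_one_le_iff_zero_less)
  \<comment> \<open>The hypothesis at \<open>k = Suc n\<close> concerns the root of the iterate just
    computed; its oddness rules out \<open>z = 0\<close>.\<close>
  then have "odd (2 ^ z * (3 ^ (u + Suc n) * b) - 1)"
    using Suc.prems step collatz_root_power by (metis order_refl)
  then obtain w where "z = Suc w"
    using assms(2) by (cases z) auto
  then show ?case
    using step z(1) by (auto simp: mult.assoc)
qed

theorem theorem3:
  fixes m a b :: int and y u :: nat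
  assumes "m > 0" and "odd m"
    and "a = collatz_root m" and "odd a"
    and "a = 2 ^ y * 3 ^ u * b - 1"
    and "y \<ge> 1" and "b \<ge> 1" and "odd b" and "\<not> 3 dvd b"
  shows "mult_factor a = 2 ^ y * 3 ^ u
    \<and> rat_of_int (mult_factor (collatz_root (reduced_collatz m)))
        = (3 * inverse 2) * rat_of_int (mult_factor a)
    \<and> rat_of_int (collatz_root (reduced_collatz m))
        = (3 * inverse 2) * 2 ^ y * 3 ^ u * rat_of_int b - 1
    \<and> collatz_root (reduced_collatz m) = 2 ^ (y - 1) * 3 ^ (u + 1) * b - 1
    \<and> (\<forall>n. (\<forall>k\<le>n. odd (collatz_root ((reduced_collatz ^^ k) m))) \<longrightarrow>
          rat_of_int (mult_factor (collatz_root ((reduced_collatz ^^ Suc n) m)))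
            = (3 * inverse 2) * rat_of_int (mult_factor (collatz_root ((reduced_collatz ^^ n) m)))
        \<and> rat_of_int (collatz_root ((reduced_collatz ^^ Suc n) m))
            = (3 * inverse 2) ^ Suc n * 2 ^ y * 3 ^ u * rat_of_int b - 1)"
proof -
  have m: "m = 2 ^ Suc y * 3 ^ u * b - 1"
  proof -
    obtain c where c: "m = 2 * c + 1"
      using assms(2) by (auto elim: oddE)
    with assms(1) have "a = c"
      using assms(3) collatz_root_eq[of c] by simp
    with c assms(5) show ?thesis
      by simp
  qed
  \<comment> \<open>The integer form of the root is carried along because its instance at
    \<open>n = 0\<close> is the formula for a single iteration.\<close>
  have one_step: "rat_of_int (mult_factor (collatz_root ((reduced_collatz ^^ Suc n) m)))
        = (3 * inverse 2) * rat_of_int (mult_factor (collatz_root ((reduced_collatz ^^ n) m)))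
      \<and> rat_of_int (collatz_root ((reduced_collatz ^^ Suc n) m))
        = (3 * inverse 2) ^ Suc n * 2 ^ y * 3 ^ u * rat_of_int b - 1
      \<and> collatz_root ((reduced_collatz ^^ Suc n) m) = 2 ^ (y - Suc n) * 3 ^ (u + Suc n) * b - 1"
    if odds: "\<forall>k\<le>n. odd (collatz_root ((reduced_collatz ^^ k) m))" for n
  proof -
    obtain z where z: "y = Suc (n + z)"
      and iter: "(reduced_collatz ^^ n) m = 2 ^ Suc (Suc z) * (3 ^ (u + n) * b) - 1"
      using reduced_collatz_funpow[of b n y u] odds assms(7,8) m by (auto simp: mult.assoc)
    have pos: "3 ^ k * b \<ge> 1" for k
      using assms(7) by (simp add: int_one_le_iff_zero_less)
    have root: "collatz_root ((reduced_collatz ^^ n) m) = 2 ^ Suc z * 3 ^ (u + n) * b - 1"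
      unfolding iter using collatz_root_power[OF pos, of "Suc z"] by (simp only: mult.assoc)
    have "(reduced_collatz ^^ Suc n) m = 2 ^ Suc z * (3 ^ (u + Suc n) * b) - 1"
      using reduced_collatz_power[of z "3 ^ (u + n) * b"] iter by (simp add: mult_ac)
    then have root': "collatz_root ((reduced_collatz ^^ Suc n) m) = 2 ^ z * 3 ^ (u + Suc n) * b - 1"
      using collatz_root_power[OF pos, of z] by (simp only: mult.assoc)
    \<comment> \<open>Since \<open>y = Suc n + z\<close>, the \<open>Suc n\<close> halvings cancel
      against \<open>2 ^ y\<close> and leave \<open>2 ^ z\<close>.\<close>
    have "(3 * inverse 2 :: rat) ^ Suc n * 2 ^ y * 3 ^ u = 2 ^ z * 3 ^ (u + Suc n)"
      unfolding z(1) by (simp add: power_add power_mult_distrib field_simps)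
    then show ?thesis
      unfolding root root' mult_factor_eq[OF assms(8,9)] using z(1) by simp
  qed
  have fst: "mult_factor a = 2 ^ y * 3 ^ u"
    unfolding assms(5) by (rule mult_factor_eq[OF assms(8,9)])
  \<comment> \<open>For a single iteration the oddness condition is just that \<open>a\<close> is
    odd.\<close>
  have "\<forall>k\<le>0. odd (collatz_root ((reduced_collatz ^^ k) m))"
    using assms(3,4) by simp
  note first = one_step[OF this]
  note first = first[THEN conjunct1] first[THEN conjunct2, THEN conjunct1]
    first[THEN conjunct2, THEN conjunct2]
  have factor: "rat_of_int (mult_factor (collatz_root (reduced_collatz m)))
      = (3 * inverse 2) * rat_of_int (mult_factor a)"
    and root: "rat_of_int (collatz_root (reduced_collatz m))
      = (3 * inverse 2) * 2 ^ y * 3 ^ u * rat_of_int b - 1"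
    and root_int: "collatz_root (reduced_collatz m) = 2 ^ (y - 1) * 3 ^ (u + 1) * b - 1"
    using first unfolding assms(3) funpow.simps o_id o_apply id_apply power_Suc power_0
    by (simp_all only: mult_1_right One_nat_def)
  show ?thesis
    by (intro conjI allI impI fst factor root root_int)
      (use one_step in \<open>blast+\<close>)
qed

end
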